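(* Let $H=(\sigma,\alpha)$ be a connected orientable hypermap and let $E'\subseteq E(H)$, with partial dual $H^{E'}=(\sigma^{E'},\alpha^{E'})$. The hyperedges of $H$ and $H^{E'}$ have the same multiset of lengths under the natural correspondence (each cycle of $\alpha$ corresponding to the cycle of $\alpha^{E'}$ on the same set of darts). More precisely, the cycle lengths of $\alpha$ and $\alpha^{E'}$ coincide exactly.
   Context: Permutations are composed from right to left. A connected orientable hypermap is a pair $H=(\sigma,\alpha)$ of permutations of a finite set $D=\{1,\dots,n\}$ of darts such that the group generated by $\sigma,\alpha$ acts transitively on $D$. Vertices are the cycles of $\sigma$ and hyperedges are the cycles of $\alpha$ (fixed points count as cycles of length 1); $E(H)$ is the set of hyperedges, and the length of a hyperedge is the length of the corresponding cycle. For $E'\subseteq E(H)$, let $\alpha_{E'}$ be the product of the $\alpha$-cycles in $E'$ and $\alpha_{\overline{E'}}$ the product of the remaining $\alpha$-cycles. The partial dual is the hypermap $H^{E'}=(\sigma^{E'},\alpha^{E'})$ with vertex permutation $\sigma^{E'}=\alpha_{E'}^{-1}\sigma$ and hyperedge permutation $\alpha^{E'}=\alpha_{E'}^{-1}\alpha_{\overline{E'}}$. *)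

theory Defs
  imports "HOL-Algebra.Sym_Groups" "HOL-Combinatorics.Orbits" "HOL-Library.Multiset"
begin

definition connected_hypermap :: "nat \<Rightarrow> (nat \<Rightarrow> nat) \<times> (nat \<Rightarrow> nat) \<Rightarrow> bool" where
  "connected_hypermap n = (\<lambda>(\<sigma>, \<alpha>).
     \<sigma> permutes {1..n} \<and> \<alpha> permutes {1..n} \<and>
     (\<forall>x\<in>{1..n}. \<forall>y\<in>{1..n}. \<exists>g \<in> generate (sym_group n) {\<sigma>, \<alpha>}. g x = y))"

text \<open>A cycle is stored as its set of darts together with the cyclic permutation it denotes
  (extended by the identity). The set of darts is needed to tell apart the cycles of length 1,
  all of which denote the identity.\<close>

type_synonym cycle = "nat set \<times> (nat \<Rightarrow> nat)"

abbreviation cycle_darts :: "cycle \<Rightarrow> nat set" where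
  "cycle_darts \<equiv> fst"

abbreviation cycle_perm :: "cycle \<Rightarrow> nat \<Rightarrow> nat" where
  "cycle_perm \<equiv> snd"

definition cycle_through :: "(nat \<Rightarrow> nat) \<Rightarrow> nat \<Rightarrow> cycle" where
  "cycle_through p x = (orbit p x, perm_restrict p (orbit p x))"

definition cycle_length :: "cycle \<Rightarrow> nat" where
  "cycle_length c = card (cycle_darts c)"

definition cycles_of :: "nat \<Rightarrow> (nat \<Rightarrow> nat) \<Rightarrow> cycle set" where
  "cycles_of n p = cycle_through p ` {1..n}"

definition hyperedges :: "nat \<Rightarrow> (nat \<Rightarrow> nat) \<times> (nat \<Rightarrow> nat) \<Rightarrow> cycle set" where
  "hyperedges n = (\<lambda>(\<sigma>, \<alpha>). cycles_of n \<alpha>)"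

text \<open>The fold does not depend on the order of the factors when the cycles in \<open>C\<close> commute;
  see \<open>cycle_prod_eq\<close> for cycles of one permutation.\<close>

definition cycle_prod :: "cycle set \<Rightarrow> nat \<Rightarrow> nat" where
  "cycle_prod C = Finite_Set.fold (\<lambda>c p. cycle_perm c \<circ> p) id C"

text \<open>Both \<open>E'\<close> and its complement consist of cycles of the old \<open>\<alpha>\<close>.
  \<open>inv'\<close> is the inverse function, as opposed to the group inverse.\<close>

definition partial_dual ::
  "nat \<Rightarrow> (nat \<Rightarrow> nat) \<times> (nat \<Rightarrow> nat) \<Rightarrow> cycle set \<Rightarrow> (nat \<Rightarrow> nat) \<times> (nat \<Rightarrow> nat)" where
  "partial_dual n = (\<lambda>(\<sigma>, \<alpha>) E'.
     (inv' (cycle_prod E') \<circ> \<sigma>,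
      inv' (cycle_prod E') \<circ> cycle_prod (hyperedges n (\<sigma>, \<alpha>) - E')))"

text \<open>The natural correspondence, on cycles of any permutation: \<open>c\<close> goes to the cycle of \<open>q\<close> on the
  same darts. It is unspecified if \<open>q\<close> has no such cycle.\<close>

definition natural_cycle :: "nat \<Rightarrow> (nat \<Rightarrow> nat) \<Rightarrow> cycle \<Rightarrow> cycle" where
  "natural_cycle n q c = (THE d. d \<in> cycles_of n q \<and> cycle_darts d = cycle_darts c)"

lemma cycles_of_E:
  assumes p: "p permutes {1..n}" and c: "c \<in> cycles_of n p"
  obtains x where "x \<in> {1..n}" "x \<in> cycle_darts c" "cycle_darts c = orbit p x"
    "cycle_perm c = perm_restrict p (cycle_darts c)"
proof -
  from c obtain x where x: "x \<in> {1..n}" "c = cycle_through p x"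
    by (auto simp: cycles_of_def)
  have "permutation p" using p permutation_permutes by blast
  then have "x \<in> orbit p x" by (rule permutation_self_in_orbit)
  with x that show ?thesis by (simp add: cycle_through_def)
qed

lemma cycles_of_closed:
  assumes p: "p permutes {1..n}" and c: "c \<in> cycles_of n p"
  shows "p y \<in> cycle_darts c \<longleftrightarrow> y \<in> cycle_darts c"
proof -
  obtain x where x: "cycle_darts c = orbit p x" using cycles_of_E[OF p c] .
  have "permutation p" using p permutation_permutes by blast
  then have "cyclic_on p (orbit p x)" by (rule cyclic_on_orbit')
  then show ?thesis unfolding x
    using cyclic_on_f_in[OF p, of "orbit p x" y] orbit.step[of y p x] by argo
qed

lemma cycles_of_disjoint:
  assumes p: "p permutes {1..n}" and "c \<in> cycles_of n p" "d \<in> cycles_of n p"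
    and y: "y \<in> cycle_darts c" "y \<in> cycle_darts d"
  shows "c = d"
proof -
  obtain u where u: "cycle_darts c = orbit p u" "cycle_perm c = perm_restrict p (cycle_darts c)"
    using cycles_of_E[OF p assms(2)] .
  obtain v where v: "cycle_darts d = orbit p v" "cycle_perm d = perm_restrict p (cycle_darts d)"
    using cycles_of_E[OF p assms(3)] .
  have "permutation p" using p permutation_permutes by blast
  then have "orbit p u = orbit p y" "orbit p v = orbit p y"
    using y u(1) v(1) orbit_cyclic_eq3[OF cyclic_on_orbit', of p y] by metis+
  then show ?thesis using u v by (simp add: prod_eq_iff)
qed

lemma cycle_prod_eq:
  assumes p: "p permutes {1..n}" and C: "C \<subseteq> cycles_of n p"
  shows "cycle_prod C = perm_restrict p (\<Union> (cycle_darts ` C))"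
proof -
  have snd: "cycle_perm c = perm_restrict p (cycle_darts c)" if "c \<in> cycles_of n p" for c
    using cycles_of_E[OF p that] .
  note closed = cycles_of_closed[OF p]
  interpret comp_fun_commute_on "cycles_of n p" "\<lambda>c q. cycle_perm c \<circ> q"
  proof
    fix c d assume cd: "c \<in> cycles_of n p" "d \<in> cycles_of n p"
    have "cycle_perm d (cycle_perm c y) = cycle_perm c (cycle_perm d y)" for y
    proof (cases "c = d")
      case False
      then have "y \<notin> cycle_darts c \<or> y \<notin> cycle_darts d"
        using cycles_of_disjoint[OF p cd, of y] by argo
      then show ?thesis
        using closed[OF cd(1), of y] closed[OF cd(2), of y]
        unfolding snd[OF cd(1)] snd[OF cd(2)] perm_restrict_def by presburger
    qed simp
    then show "(\<circ>) (cycle_perm d) \<circ> (\<circ>) (cycle_perm c) =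
        (\<circ>) (cycle_perm c) \<circ> (\<circ>) (cycle_perm d)"
      by (simp add: fun_eq_iff)
  qed
  have "finite C" using finite_subset[OF C] by (simp add: cycles_of_def)
  then show ?thesis using C
  proof (induction C)
    case empty
    then show ?case by (simp add: cycle_prod_def perm_restrict_def fun_eq_iff)
  next
    case (insert c C)
    let ?U = "\<Union> (cycle_darts ` C)"
    have "cycle_prod (insert c C) = cycle_perm c \<circ> cycle_prod C"
      using insert by (simp add: cycle_prod_def)
    also have "\<dots> = perm_restrict p (cycle_darts c) \<circ> perm_restrict p ?U"
      using insert snd[of c] by simp
    also have "\<dots> = perm_restrict p (cycle_darts c \<union> ?U)"
    proof
      fix y
      have c: "p y \<in> cycle_darts c \<longleftrightarrow> y \<in> cycle_darts c"
        using insert.prems closed by blast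
      have "cycle_darts c \<inter> ?U = {}"
        using insert cycles_of_disjoint[OF p, of c] by blast
      then show "(perm_restrict p (cycle_darts c) \<circ> perm_restrict p ?U) y =
          perm_restrict p (cycle_darts c \<union> ?U) y"
        using c by (cases "y \<in> cycle_darts c"; cases "y \<in> ?U")
          (simp_all add: perm_restrict_def disjoint_iff del: Union_iff UN_iff)
    qed
    finally show ?case by simp
  qed
qed

end

theory Submission
  imports Defs
begin

text \<open>
  Write \<open>U\<close> for the set of darts covered by the hyperedges in \<open>E'\<close>. Since \<open>U\<close> is a union of
  cycles of \<open>\<alpha>\<close>, the permutation \<open>\<alpha>\<close> splits into its action on \<open>U\<close> and its action off \<open>U\<close>,
  and the hyperedge permutation of the partial dual is \<open>\<alpha>\<close> with the first part inverted
  (\<open>partial_dual_hyperedge_perm\<close>). Inverting a permutation reverses its cycles without changing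
  the sets of darts that they visit, so \<open>\<alpha>\<close> and the new permutation have the same orbits
  (\<open>orbit_invert_on\<close>). A cycle is determined by the permutation and its orbit, so permutations with
  the same orbits have cycles that correspond one to one, with equal dart sets and hence equal
  lengths (\<open>natural_cycle_bij\<close>).
\<close>

text \<open>An orbit meets \<open>U\<close> only if it lies inside \<open>U\<close>, so each orbit sees just one of the two
  branches. A permutation in the sense of \<^const>\<open>permutation\<close> has finite cycles; running
  backwards around such a cycle reaches the same points as running forwards.\<close>

lemma orbit_invert_on:
  assumes p: "permutation p" and closed: "\<And>y. p y \<in> U \<longleftrightarrow> y \<in> U"
  shows "orbit (\<lambda>y. if y \<in> U then inv' p y else p y) x = orbit p x"
proof -
  let ?q = "\<lambda>y. if y \<in> U then inv' p y else p y"
  have closed_inv: "inv' p y \<in> U \<longleftrightarrow> y \<in> U" for y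
    using closed[of "inv' p y"] p
    by (simp add: permutation_bijective bij_is_surj surj_f_inv_f)
  show ?thesis
  proof (cases "x \<in> U")
    case True
    then have "orbit ?q x = orbit (inv' p) x"
      by (rule orbit_cong0) (simp_all add: closed_inv)
    then show ?thesis by (simp add: orbit_inv_eq[OF p])
  next
    case False
    then have "x \<in> - U" by simp
    then show ?thesis
      by (rule orbit_cong0) (simp_all add: closed)
  qed
qed

lemma natural_cycle_cycle_through:
  assumes x: "x \<in> {1..n}" and orb: "orbit q x = orbit p x"
  shows "natural_cycle n q (cycle_through p x) = cycle_through q x"
  unfolding natural_cycle_def
proof (rule the_equality)
  show "cycle_through q x \<in> cycles_of n q \<and>
      cycle_darts (cycle_through q x) = cycle_darts (cycle_through p x)"
    unfolding cycles_of_def using imageI[OF x, of "cycle_through q"] orb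
    by (simp add: cycle_through_def)
next
  fix d
  assume "d \<in> cycles_of n q \<and> cycle_darts d = cycle_darts (cycle_through p x)"
  then show "d = cycle_through q x"
    using orb by (auto simp: cycles_of_def cycle_through_def)
qed

lemma cycle_darts_natural_cycle:
  assumes orb: "\<And>x. x \<in> {1..n} \<Longrightarrow> orbit q x = orbit p x" and c: "c \<in> cycles_of n p"
  shows "cycle_darts (natural_cycle n q c) = cycle_darts c"
proof -
  from c obtain x where x: "x \<in> {1..n}" "c = cycle_through p x"
    by (auto simp: cycles_of_def)
  then show ?thesis
    using natural_cycle_cycle_through[OF x(1) orb[OF x(1)]] orb[OF x(1)]
    by (simp add: cycle_through_def)
qed

lemma natural_cycle_bij:
  assumes orb: "\<And>x. x \<in> {1..n} \<Longrightarrow> orbit q x = orbit p x"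
  shows "bij_betw (natural_cycle n q) (cycles_of n p) (cycles_of n q)"
proof (rule bij_betw_imageI)
  show "inj_on (natural_cycle n q) (cycles_of n p)"
  proof (rule inj_onI)
    fix c d
    assume cd: "c \<in> cycles_of n p" "d \<in> cycles_of n p"
      and "natural_cycle n q c = natural_cycle n q d"
    then have "cycle_darts c = cycle_darts d"
      using cycle_darts_natural_cycle[OF orb] by metis
    then show "c = d" using cd by (auto simp: cycles_of_def cycle_through_def)
  qed
  show "natural_cycle n q ` cycles_of n p = cycles_of n q"
    using natural_cycle_cycle_through[OF _ orb]
    by (simp add: cycles_of_def image_image)
qed

lemma Union_cycles_of_closed:
  assumes p: "p permutes {1..n}" and C: "C \<subseteq> cycles_of n p"
  shows "p y \<in> \<Union> (cycle_darts ` C) \<longleftrightarrow> y \<in> \<Union> (cycle_darts ` C)"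
  using cycles_of_closed[OF p] C by blast

text \<open>The two products of cycles are supported on disjoint sets of darts, each invariant
  under \<open>\<alpha>\<close>, so at every point at most one of the two composed factors acts.\<close>

lemma partial_dual_hyperedge_perm:
  assumes p: "\<alpha> permutes {1..n}" and C: "E' \<subseteq> hyperedges n (\<sigma>, \<alpha>)"
  shows "snd (partial_dual n (\<sigma>, \<alpha>) E') =
    (\<lambda>y. if y \<in> \<Union> (cycle_darts ` E') then inv' \<alpha> y else \<alpha> y)"
proof
  fix y
  define U where "U = \<Union> (cycle_darts ` E')"
  define V where "V = \<Union> (cycle_darts ` (cycles_of n \<alpha> - E'))"
  let ?b = "perm_restrict \<alpha> U"
  have C': "E' \<subseteq> cycles_of n \<alpha>" using C by (simp add: hyperedges_def)
  have closed: "\<alpha> z \<in> U \<longleftrightarrow> z \<in> U" for z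
    unfolding U_def by (rule Union_cycles_of_closed[OF p C'])
  have inj: "inj ?b"
  proof (rule injI)
    fix u v assume "?b u = ?b v"
    then show "u = v"
      using closed[of u] closed[of v] permutes_inj[OF p, THEN injD, of u v]
      by (simp add: perm_restrict_def split: if_splits)
  qed
  have inv_b: "inv' ?b z = (if z \<in> U then inv' \<alpha> z else z)" for z
    using closed[of "inv' \<alpha> z"] permutes_inverses(1)[OF p, of z]
    by (intro inv_f_eq[OF inj]) (simp add: perm_restrict_def)
  have off_E': "perm_restrict \<alpha> V z = (if z \<in> U then z else \<alpha> z)" for z
  proof -
    have "z \<notin> V" if "z \<in> U"
      using that C' cycles_of_disjoint[OF p] unfolding U_def V_def by blast
    moreover have "\<alpha> z = z" if "z \<notin> U" "z \<notin> V"
    proof -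
      \<comment> \<open>Every dart lies on some cycle, so \<open>z\<close> is not a dart at all.\<close>
      have "z \<notin> {1..n}"
      proof
        assume "z \<in> {1..n}"
        then have "cycle_through \<alpha> z \<in> cycles_of n \<alpha>" by (simp add: cycles_of_def)
        moreover have "permutation \<alpha>" using p permutation_permutes by blast
        then have "z \<in> cycle_darts (cycle_through \<alpha> z)"
          by (simp add: cycle_through_def permutation_self_in_orbit)
        ultimately show False using that C' unfolding U_def V_def by blast
      qed
      then show ?thesis using p by (simp add: permutes_not_in)
    qed
    ultimately show ?thesis by (auto simp: perm_restrict_def)
  qed
  have "snd (partial_dual n (\<sigma>, \<alpha>) E') y = inv' ?b (perm_restrict \<alpha> V y)"
    using cycle_prod_eq[OF p C'] cycle_prod_eq[OF p, of "cycles_of n \<alpha> - E'"]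
    by (simp add: partial_dual_def hyperedges_def U_def V_def)
  then show "snd (partial_dual n (\<sigma>, \<alpha>) E') y =
      (if y \<in> \<Union> (cycle_darts ` E') then inv' \<alpha> y else \<alpha> y)"
    using closed[of y] unfolding U_def[symmetric] by (simp add: inv_b off_E')
qed

theorem corollary2p5:
  fixes n :: nat and \<sigma> \<alpha> \<sigma>' \<alpha>' :: "nat \<Rightarrow> nat" and E' :: "cycle set"
  assumes "connected_hypermap n (\<sigma>, \<alpha>)"
    and "E' \<subseteq> hyperedges n (\<sigma>, \<alpha>)"
    and "(\<sigma>', \<alpha>') = partial_dual n (\<sigma>, \<alpha>) E'"
  shows "bij_betw (natural_cycle n \<alpha>') (hyperedges n (\<sigma>, \<alpha>)) (hyperedges n (\<sigma>', \<alpha>'))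
    \<and> (\<forall>e \<in> hyperedges n (\<sigma>, \<alpha>).
         cycle_darts (natural_cycle n \<alpha>' e) = cycle_darts e \<and>
         cycle_length (natural_cycle n \<alpha>' e) = cycle_length e)
    \<and> image_mset cycle_length (mset_set (hyperedges n (\<sigma>, \<alpha>))) =
      image_mset cycle_length (mset_set (hyperedges n (\<sigma>', \<alpha>')))"
proof -
  let ?U = "\<Union> (cycle_darts ` E')"
  have p: "\<alpha> permutes {1..n}" using assms(1) by (simp add: connected_hypermap_def)
  then have perm: "permutation \<alpha>" using permutation_permutes by blast
  have closed: "\<alpha> y \<in> ?U \<longleftrightarrow> y \<in> ?U" for y
    using Union_cycles_of_closed[OF p] assms(2) unfolding hyperedges_def by simp
  have "\<alpha>' = (\<lambda>y. if y \<in> ?U then inv' \<alpha> y else \<alpha> y)"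
    using partial_dual_hyperedge_perm[OF p assms(2)] assms(3) by (metis snd_conv)
  then have orb: "orbit \<alpha>' x = orbit \<alpha> x" for x
    using orbit_invert_on[OF perm closed] by simp
  have bij: "bij_betw (natural_cycle n \<alpha>') (cycles_of n \<alpha>) (cycles_of n \<alpha>')"
    using natural_cycle_bij orb by blast
  have darts: "cycle_darts (natural_cycle n \<alpha>' e) = cycle_darts e" if "e \<in> cycles_of n \<alpha>" for e
    using cycle_darts_natural_cycle orb that by blast
  have "mset_set (cycles_of n \<alpha>') = image_mset (natural_cycle n \<alpha>') (mset_set (cycles_of n \<alpha>))"
    using image_mset_mset_set[of "natural_cycle n \<alpha>'"] bij by (metis bij_betw_def)
  then have "image_mset cycle_length (mset_set (cycles_of n \<alpha>')) =
      image_mset (\<lambda>e. cycle_length (natural_cycle n \<alpha>' e)) (mset_set (cycles_of n \<alpha>))"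
    by (simp add: multiset.map_comp comp_def)
  also have "\<dots> = image_mset cycle_length (mset_set (cycles_of n \<alpha>))"
    by (rule image_mset_cong) (simp add: cycle_length_def darts cycles_of_def)
  finally show ?thesis
    using bij darts by (simp add: hyperedges_def cycle_length_def)
qed

end
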